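(* Let $A$ be a finite-dimensional algebra over an algebraically closed field $k$, and let $S$ be a simple reflexive left $A$-module. Then $S^*$ is a torsionless right $A$-module, and no proper non-zero factor module of $S^*$ is torsionless. In particular, $S^*$ is a brick.
   Context: Modules have finite length. For a left $A$-module $M$, let $M^*=\operatorname{Hom}_A(M,{}_AA)$, considered as a right $A$-module; similarly, for a right $A$-module $N$, $N^*=\operatorname{Hom}_A(N,A_A)$, considered as a left $A$-module. Let $\phi_M\colon M\to M^{**}$ be the canonical evaluation map $m\mapsto (f\mapsto f(m))$. A (left or right) module $M$ is torsionless if it is isomorphic to a submodule of a projective module (equivalently, $\phi_M$ is injective), and reflexive if $\phi_M$ is bijective. A proper factor module of $N$ is a factor module $N/U$ with $U\ne 0$. A brick is a module whose endomorphism ring is a division ring. *)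

theory Defs
  imports "HOL-Algebra.Module" "HOL-Algebra.AbelCoset" "HOL-Algebra.Algebraic_Closure"
begin

text \<open>
  HOL-Algebra's \<open>module\<close> locale is restricted to commutative base rings, so one-sided modules
  are introduced here. They use the record type \<open>module\<close> of HOL-Algebra, whose ring fields
  \<open>mult\<close> and \<open>one\<close> play no role for a module and are left \<open>undefined\<close> in the
  constructions below. The locale \<open>submodule\<close> of HOL-Algebra (additive subgroup closed under
  the action) makes no commutativity assumption and is used for left and right modules alike.
  Maps are functions that are \<open>undefined\<close> outside their domain, so that equality of
  homomorphisms is equality of functions.
\<close>

section \<open>Finite-dimensional algebras\<close>

text \<open>The scalar multiplication of the record \<open>A\<close> is the action of the ground field.\<close>

locale finite_dim_algebra = module K A + ring A
  for K :: "('k, 'l) ring_scheme" and A :: "('k, 'a, 'm) module_scheme" (structure) +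
  assumes field_K: "field K"
    and smult_mult_left: "\<lbrakk>c \<in> carrier K; x \<in> carrier A; y \<in> carrier A\<rbrakk>
      \<Longrightarrow> (c \<odot> x) \<otimes> y = c \<odot> (x \<otimes> y)"
    and smult_mult_right: "\<lbrakk>c \<in> carrier K; x \<in> carrier A; y \<in> carrier A\<rbrakk>
      \<Longrightarrow> x \<otimes> (c \<odot> y) = c \<odot> (x \<otimes> y)"
    and finite_dim: "\<exists>B. finite B \<and> B \<subseteq> carrier A \<and>
      (\<forall>x \<in> carrier A. \<exists>c \<in> B \<rightarrow> carrier K. x = (\<Oplus>b\<in>B. c b \<odot> b))"

section \<open>One-sided modules\<close>

locale left_module = A: ring A + abelian_group M
  for A :: "('a, 'l) ring_scheme" and M :: "('a, 'b, 'n) module_scheme" (structure) +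
  assumes smult_closed: "\<lbrakk>a \<in> carrier A; x \<in> carrier M\<rbrakk> \<Longrightarrow> a \<odot> x \<in> carrier M"
    and smult_l_distr: "\<lbrakk>a \<in> carrier A; b \<in> carrier A; x \<in> carrier M\<rbrakk>
      \<Longrightarrow> (a \<oplus>\<^bsub>A\<^esub> b) \<odot> x = a \<odot> x \<oplus> b \<odot> x"
    and smult_r_distr: "\<lbrakk>a \<in> carrier A; x \<in> carrier M; y \<in> carrier M\<rbrakk>
      \<Longrightarrow> a \<odot> (x \<oplus> y) = a \<odot> x \<oplus> a \<odot> y"
    and smult_assoc: "\<lbrakk>a \<in> carrier A; b \<in> carrier A; x \<in> carrier M\<rbrakk>
      \<Longrightarrow> (a \<otimes>\<^bsub>A\<^esub> b) \<odot> x = a \<odot> (b \<odot> x)"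
    and smult_one: "x \<in> carrier M \<Longrightarrow> \<one>\<^bsub>A\<^esub> \<odot> x = x"

text \<open>In a right module, \<open>a \<odot> x\<close> stands for the product \<open>x a\<close>; hence the reversed
  order in \<open>smult_assoc\<close>.\<close>

locale right_module = A: ring A + abelian_group M
  for A :: "('a, 'l) ring_scheme" and M :: "('a, 'b, 'n) module_scheme" (structure) +
  assumes smult_closed: "\<lbrakk>a \<in> carrier A; x \<in> carrier M\<rbrakk> \<Longrightarrow> a \<odot> x \<in> carrier M"
    and smult_l_distr: "\<lbrakk>a \<in> carrier A; b \<in> carrier A; x \<in> carrier M\<rbrakk>
      \<Longrightarrow> (a \<oplus>\<^bsub>A\<^esub> b) \<odot> x = a \<odot> x \<oplus> b \<odot> x"
    and smult_r_distr: "\<lbrakk>a \<in> carrier A; x \<in> carrier M; y \<in> carrier M\<rbrakk>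
      \<Longrightarrow> a \<odot> (x \<oplus> y) = a \<odot> x \<oplus> a \<odot> y"
    and smult_assoc: "\<lbrakk>a \<in> carrier A; b \<in> carrier A; x \<in> carrier M\<rbrakk>
      \<Longrightarrow> (a \<otimes>\<^bsub>A\<^esub> b) \<odot> x = b \<odot> (a \<odot> x)"
    and smult_one: "x \<in> carrier M \<Longrightarrow> \<one>\<^bsub>A\<^esub> \<odot> x = x"

definition left_regular :: "('a, 'l) ring_scheme \<Rightarrow> ('a, 'a) module" where
  "left_regular A = \<lparr>carrier = carrier A, monoid.mult = undefined, one = undefined,
     zero = \<zero>\<^bsub>A\<^esub>, add = (\<oplus>\<^bsub>A\<^esub>), smult = (\<lambda>a x. a \<otimes>\<^bsub>A\<^esub> x)\<rparr>"

definition right_regular :: "('a, 'l) ring_scheme \<Rightarrow> ('a, 'a) module" where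
  "right_regular A = \<lparr>carrier = carrier A, monoid.mult = undefined, one = undefined,
     zero = \<zero>\<^bsub>A\<^esub>, add = (\<oplus>\<^bsub>A\<^esub>), smult = (\<lambda>a x. x \<otimes>\<^bsub>A\<^esub> a)\<rparr>"

definition simple_left_module ::
  "('a, 'l) ring_scheme \<Rightarrow> ('a, 'b, 'n) module_scheme \<Rightarrow> bool" where
  "simple_left_module A M \<longleftrightarrow> left_module A M \<and> carrier M \<noteq> {\<zero>\<^bsub>M\<^esub>} \<and>
     (\<forall>U. submodule U A M \<longrightarrow> U = {\<zero>\<^bsub>M\<^esub>} \<or> U = carrier M)"

text \<open>The factor module \<open>M/U\<close>, with cosets of \<open>U\<close> as elements.\<close>

definition factor_module :: "('a, 'b, 'n) module_scheme \<Rightarrow> 'b set \<Rightarrow> ('a, 'b set) module" where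
  "factor_module M U = \<lparr>carrier = a_rcosets\<^bsub>M\<^esub> U, monoid.mult = undefined, one = undefined,
     zero = U, add = set_add M, smult = (\<lambda>a C. \<Union>x\<in>C. U +>\<^bsub>M\<^esub> (a \<odot>\<^bsub>M\<^esub> x))\<rparr>"

definition direct_power :: "nat \<Rightarrow> ('a, 'b, 'n) module_scheme \<Rightarrow> ('a, nat \<Rightarrow> 'b) module" where
  "direct_power n M = \<lparr>carrier = {..<n} \<rightarrow>\<^sub>E carrier M, monoid.mult = undefined, one = undefined,
     zero = (\<lambda>i\<in>{..<n}. \<zero>\<^bsub>M\<^esub>), add = (\<lambda>x y. \<lambda>i\<in>{..<n}. x i \<oplus>\<^bsub>M\<^esub> y i),
     smult = (\<lambda>a x. \<lambda>i\<in>{..<n}. a \<odot>\<^bsub>M\<^esub> x i)\<rparr>"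

section \<open>Homomorphisms, duals and bricks\<close>

definition mod_hom :: "('a, 'l) ring_scheme \<Rightarrow> ('a, 'b, 'm) module_scheme \<Rightarrow>
    ('a, 'c, 'n) module_scheme \<Rightarrow> ('b \<Rightarrow> 'c) set" where
  "mod_hom A M N = {f \<in> carrier M \<rightarrow>\<^sub>E carrier N.
     (\<forall>x\<in>carrier M. \<forall>y\<in>carrier M. f (x \<oplus>\<^bsub>M\<^esub> y) = f x \<oplus>\<^bsub>N\<^esub> f y) \<and>
     (\<forall>a\<in>carrier A. \<forall>x\<in>carrier M. f (a \<odot>\<^bsub>M\<^esub> x) = a \<odot>\<^bsub>N\<^esub> f x)}"

definition mod_isomorphic :: "('a, 'l) ring_scheme \<Rightarrow> ('a, 'b, 'm) module_scheme \<Rightarrow>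
    ('a, 'c, 'n) module_scheme \<Rightarrow> bool" where
  "mod_isomorphic A M N \<longleftrightarrow> (\<exists>f\<in>mod_hom A M N. bij_betw f (carrier M) (carrier N))"

text \<open>The dual of a left module is a right module via \<open>(f a)(x) = f(x) a\<close>, and the dual of a
  right module is a left module via \<open>(a f)(x) = a f(x)\<close>.\<close>

definition left_dual ::
  "('a, 'l) ring_scheme \<Rightarrow> ('a, 'b, 'n) module_scheme \<Rightarrow> ('a, 'b \<Rightarrow> 'a) module" where
  "left_dual A M = \<lparr>carrier = mod_hom A M (left_regular A), monoid.mult = undefined, one = undefined,
     zero = (\<lambda>x\<in>carrier M. \<zero>\<^bsub>A\<^esub>), add = (\<lambda>f g. \<lambda>x\<in>carrier M. f x \<oplus>\<^bsub>A\<^esub> g x),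
     smult = (\<lambda>a f. \<lambda>x\<in>carrier M. f x \<otimes>\<^bsub>A\<^esub> a)\<rparr>"

definition right_dual ::
  "('a, 'l) ring_scheme \<Rightarrow> ('a, 'b, 'n) module_scheme \<Rightarrow> ('a, 'b \<Rightarrow> 'a) module" where
  "right_dual A N = \<lparr>carrier = mod_hom A N (right_regular A), monoid.mult = undefined, one = undefined,
     zero = (\<lambda>x\<in>carrier N. \<zero>\<^bsub>A\<^esub>), add = (\<lambda>f g. \<lambda>x\<in>carrier N. f x \<oplus>\<^bsub>A\<^esub> g x),
     smult = (\<lambda>a f. \<lambda>x\<in>carrier N. a \<otimes>\<^bsub>A\<^esub> f x)\<rparr>"

definition left_eval_map ::
  "('a, 'l) ring_scheme \<Rightarrow> ('a, 'b, 'n) module_scheme \<Rightarrow> 'b \<Rightarrow> (('b \<Rightarrow> 'a) \<Rightarrow> 'a)" where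
  "left_eval_map A M = (\<lambda>m\<in>carrier M. \<lambda>f\<in>carrier (left_dual A M). f m)"

definition left_reflexive ::
  "('a, 'l) ring_scheme \<Rightarrow> ('a, 'b, 'n) module_scheme \<Rightarrow> bool" where
  "left_reflexive A M \<longleftrightarrow> left_module A M \<and>
     bij_betw (left_eval_map A M) (carrier M) (carrier (right_dual A (left_dual A M)))"

definition endomorphism_ring ::
  "('a, 'l) ring_scheme \<Rightarrow> ('a, 'b, 'n) module_scheme \<Rightarrow> ('b \<Rightarrow> 'b) ring" where
  "endomorphism_ring A M = \<lparr>carrier = mod_hom A M M, monoid.mult = compose (carrier M),
     one = (\<lambda>x\<in>carrier M. x), zero = (\<lambda>x\<in>carrier M. \<zero>\<^bsub>M\<^esub>),
     add = (\<lambda>f g. \<lambda>x\<in>carrier M. f x \<oplus>\<^bsub>M\<^esub> g x)\<rparr>"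

locale skew_field = ring R for R (structure) +
  assumes one_not_zero: "\<one> \<noteq> \<zero>"
    and Units_eq: "Units R = carrier R - {\<zero>}"

definition brick :: "('a, 'l) ring_scheme \<Rightarrow> ('a, 'b, 'n) module_scheme \<Rightarrow> bool" where
  "brick A M \<longleftrightarrow> skew_field (endomorphism_ring A M)"

section \<open>Projective and torsionless right modules\<close>

text \<open>Modules have finite length, so a projective module is a direct summand of a free module
  of finite rank.\<close>

definition right_projective ::
  "('a, 'l) ring_scheme \<Rightarrow> ('a, 'b, 'n) module_scheme \<Rightarrow> bool" where
  "right_projective A P \<longleftrightarrow> right_module A P \<and>
     (\<exists>n U V. let F = direct_power n (right_regular A) in
        submodule U A F \<and> submodule V A F \<and> U \<inter> V = {\<zero>\<^bsub>F\<^esub>} \<and> U <+>\<^bsub>F\<^esub> V = carrier F \<and>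
        mod_isomorphic A P (F\<lparr>carrier := U\<rparr>))"

text \<open>Every projective module of finite length has an isomorphic copy inside some
  \<open>A\<^sup>n\<close>, hence on the type \<open>nat \<Rightarrow> 'a\<close>; fixing this type for \<open>P\<close> loses nothing.\<close>

definition right_torsionless ::
  "('a, 'l) ring_scheme \<Rightarrow> ('a, 'b, 'n) module_scheme \<Rightarrow> bool" where
  "right_torsionless A N \<longleftrightarrow> right_module A N \<and>
     (\<exists>(P :: ('a, nat \<Rightarrow> 'a) module) U. right_projective A P \<and> submodule U A P \<and>
        mod_isomorphic A N (P\<lparr>carrier := U\<rparr>))"

section \<open>Well-definedness of the constructions\<close>

lemma (in left_module) left_dual_right_module: "right_module A (left_dual A M)"
proof -
  have c: "f \<in> carrier (left_dual A M) \<longleftrightarrow> f \<in> carrier M \<rightarrow>\<^sub>E carrier A \<and>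
    (\<forall>x\<in>carrier M. \<forall>y\<in>carrier M. f (x \<oplus> y) = f x \<oplus>\<^bsub>A\<^esub> f y) \<and>
     (\<forall>a\<in>carrier A. \<forall>x\<in>carrier M. f (a \<odot> x) = a \<otimes>\<^bsub>A\<^esub> f x)" for f
    by (simp add: left_dual_def mod_hom_def left_regular_def)
  have s: "\<zero>\<^bsub>left_dual A M\<^esub> = (\<lambda>x\<in>carrier M. \<zero>\<^bsub>A\<^esub>)"
     "f \<oplus>\<^bsub>left_dual A M\<^esub> g = (\<lambda>x\<in>carrier M. f x \<oplus>\<^bsub>A\<^esub> g x)"
     "a \<odot>\<^bsub>left_dual A M\<^esub> f = (\<lambda>x\<in>carrier M. f x \<otimes>\<^bsub>A\<^esub> a)" for a f g
    by (simp_all add: left_dual_def)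
  have e: "f x \<in> carrier A" if "f \<in> carrier (left_dual A M)" "x \<in> carrier M" for f x
    using that by (auto simp: c)
  have ab: "abelian_group (left_dual A M)"
  proof (rule abelian_groupI)
    fix f g h assume f: "f \<in> carrier (left_dual A M)" and g: "g \<in> carrier (left_dual A M)"
      and h: "h \<in> carrier (left_dual A M)"
    note E = e[OF f] e[OF g] e[OF h]
    show "f \<oplus>\<^bsub>left_dual A M\<^esub> g \<in> carrier (left_dual A M)"
      using f g E by (auto simp: c s A.a_ac A.r_distr smult_closed)
    show "f \<oplus>\<^bsub>left_dual A M\<^esub> g \<oplus>\<^bsub>left_dual A M\<^esub> h = f \<oplus>\<^bsub>left_dual A M\<^esub> (g \<oplus>\<^bsub>left_dual A M\<^esub> h)"
      using E by (auto simp: s A.a_ac intro!: restrict_ext)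
  next
    fix f g assume f: "f \<in> carrier (left_dual A M)" and g: "g \<in> carrier (left_dual A M)"
    show "f \<oplus>\<^bsub>left_dual A M\<^esub> g = g \<oplus>\<^bsub>left_dual A M\<^esub> f"
      using e[OF f] e[OF g] by (auto simp: s A.a_ac intro!: restrict_ext)
  next
    fix f assume f: "f \<in> carrier (left_dual A M)"
    show "\<zero>\<^bsub>left_dual A M\<^esub> \<oplus>\<^bsub>left_dual A M\<^esub> f = f"
      using f e[OF f] by (auto simp: s c PiE_def extensional_def fun_eq_iff)
    show "\<exists>g\<in>carrier (left_dual A M). g \<oplus>\<^bsub>left_dual A M\<^esub> f = \<zero>\<^bsub>left_dual A M\<^esub>"
    proof
      show "(\<lambda>x\<in>carrier M. \<ominus>\<^bsub>A\<^esub> f x) \<in> carrier (left_dual A M)"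
        using f e[OF f] by (auto simp: c A.minus_add A.r_minus smult_closed)
      show "(\<lambda>x\<in>carrier M. \<ominus>\<^bsub>A\<^esub> f x) \<oplus>\<^bsub>left_dual A M\<^esub> f = \<zero>\<^bsub>left_dual A M\<^esub>"
        using f e[OF f] by (auto simp: s A.l_neg intro!: restrict_ext)
    qed
  qed (auto simp: c s smult_closed)
  interpret D: abelian_group "left_dual A M" by (fact ab)
  show ?thesis
  proof (unfold_locales, goal_cases)
    case (1 a f) then show ?case using e[OF 1(2)] by (auto simp: c s A.m_assoc A.l_distr smult_closed)
  next case (2 a b f) then show ?case using e[OF 2(3)] by (auto simp: s A.r_distr intro!: restrict_ext)
  next case (3 a f g) then show ?case using e[OF 3(2)] e[OF 3(3)] by (auto simp: s A.l_distr intro!: restrict_ext)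
  next case (4 a b f) then show ?case using e[OF 4(3)] by (auto simp: s A.m_assoc intro!: restrict_ext)
  next case (5 f) then show ?case using e[OF 5] by (auto simp: s c PiE_def extensional_def fun_eq_iff)
  qed
qed

lemma (in right_module) factor_module_right_module:
  assumes U: "submodule U A M"
  shows "right_module A (factor_module M U)"
proof -
  interpret U: submodule U A M by fact
  have "abelian_subgroup U M"
    by (rule abelian_subgroupI3) (auto intro: additive_subgroup.intro U.subgroup_axioms abelian_group_axioms)
  then interpret U: abelian_subgroup U M .
  interpret Q: comm_group "M A_Mod U" by (rule U.a_factorgroup_is_comm_group)
  have fc: "carrier (factor_module M U) = carrier (M A_Mod U)"
    "\<zero>\<^bsub>factor_module M U\<^esub> = \<one>\<^bsub>M A_Mod U\<^esub>"
    "x \<oplus>\<^bsub>factor_module M U\<^esub> y = x \<otimes>\<^bsub>M A_Mod U\<^esub> y" for x y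
    by (simp_all add: factor_module_def A_FactGroup_def FactGroup_def A_RCOSETS_def set_add_def)
  have ab: "abelian_group (factor_module M U)"
  proof (rule abelian_groupI, unfold fc, goal_cases)
    case (1 x y) then show ?case by (rule Q.m_closed)
  next case 2 show ?case by (rule Q.one_closed)
  next case (3 x y z) then show ?case by (rule Q.m_assoc)
  next case (4 x y) then show ?case by (rule Q.m_comm)
  next case (5 x) then show ?case by (rule Q.l_one)
  next case (6 x) then show ?case using Q.l_inv Q.inv_closed by blast
  qed
  have ex: "\<exists>x\<in>carrier M. C = U +> x" if "C \<in> carrier (factor_module M U)" for C
    using that by (auto simp: factor_module_def A_RCOSETS_defs a_r_coset_def r_coset_def)
  have cl: "U +> x \<in> carrier (factor_module M U)" if "x \<in> carrier M" for x
    using that by (auto simp: factor_module_def A_RCOSETS_defs a_r_coset_def r_coset_def)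
  have ad: "(U +> x) \<oplus>\<^bsub>factor_module M U\<^esub> (U +> y) = U +> (x \<oplus> y)" if "x \<in> carrier M" "y \<in> carrier M" for x y
    using that by (simp add: factor_module_def U.a_rcos_sum)
  have sm: "a \<odot>\<^bsub>factor_module M U\<^esub> (U +> x) = U +> (a \<odot> x)" if a: "a \<in> carrier A" and x: "x \<in> carrier M" for a x
  proof -
    have "U +> (a \<odot> z) = U +> (a \<odot> x)" if "z \<in> U +> x" for z
    proof -
      obtain u where u: "u \<in> U" "z = u \<oplus> x" using \<open>z \<in> U +> x\<close> by (auto simp: a_r_coset_def r_coset_def)
      have uM: "u \<in> carrier M" using u U.a_subset by blast
      have "a \<odot> z = a \<odot> u \<oplus> a \<odot> x" using u uM a x smult_r_distr by auto
      then have "a \<odot> z \<in> U +> (a \<odot> x)" using u(1) a by (auto simp: a_r_coset_def r_coset_def)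
      then show ?thesis using smult_closed[OF a x] U.a_repr_independence' by metis
    qed
    moreover have "x \<in> U +> x" using x by (rule U.a_rcos_self)
    ultimately have "(\<Union>z\<in>U +> x. U +> (a \<odot> z)) = U +> (a \<odot> x)" by blast
    then show ?thesis by (simp add: factor_module_def)
  qed
  interpret D: abelian_group "factor_module M U" by (fact ab)
  show ?thesis
  proof (unfold_locales, goal_cases)
    case (1 a f) then show ?case by (metis ex cl sm smult_closed)
  next case (2 a b f) then show ?case using ex[OF 2(3)] by (auto simp: sm ad smult_l_distr smult_closed)
  next case (3 a f g) then show ?case using ex[OF 3(2)] ex[OF 3(3)] by (auto simp: sm ad smult_r_distr smult_closed)
  next case (4 a b f) then show ?case using ex[OF 4(3)] by (auto simp: sm smult_assoc smult_closed)
  next case (5 f) then show ?case using ex[OF 5] by (auto simp: sm smult_one)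
  qed
qed

lemma (in right_module) direct_power_right_module: "right_module A (direct_power n M)"
proof -
  let ?D = "direct_power n M"
  have c: "carrier ?D = {..<n} \<rightarrow>\<^sub>E carrier M" by (simp add: direct_power_def)
  have s: "\<zero>\<^bsub>?D\<^esub> = (\<lambda>x\<in>{..<n}. \<zero>)"
     "f \<oplus>\<^bsub>?D\<^esub> g = (\<lambda>x\<in>{..<n}. f x \<oplus> g x)"
     "a \<odot>\<^bsub>?D\<^esub> f = (\<lambda>x\<in>{..<n}. a \<odot> f x)" for a f g
    by (simp_all add: direct_power_def)
  have e: "f x \<in> carrier M" if "f \<in> carrier ?D" "x < n" for f x
    using that by (auto simp: c)
  have ab: "abelian_group ?D"
  proof (rule abelian_groupI, goal_cases)
    case (1 f g) then show ?case by (auto simp: c s)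
  next case 2 show ?case by (auto simp: c s)
  next case (3 f g h) show ?case using e[OF 3(1)] e[OF 3(2)] e[OF 3(3)] by (auto simp: s a_ac intro!: restrict_ext)
  next case (4 f g) show ?case using e[OF 4(1)] e[OF 4(2)] by (auto simp: s a_ac intro!: restrict_ext)
  next case (5 f) then show ?case using e[OF 5] by (auto simp: s c PiE_def extensional_def fun_eq_iff)
  next case (6 f) show ?case
    by (rule bexI[of _ "\<lambda>x\<in>{..<n}. \<ominus> f x"]) (use e[OF 6] in \<open>auto simp: c s l_neg intro!: restrict_ext\<close>)
  qed
  interpret D: abelian_group ?D by (fact ab)
  show ?thesis
  proof (unfold_locales, goal_cases)
    case (1 a f) then show ?case using e[OF 1(2)] by (auto simp: c s smult_closed)
  next case (2 a b f) then show ?case using e[OF 2(3)] by (auto simp: s smult_l_distr intro!: restrict_ext)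
  next case (3 a f g) then show ?case using e[OF 3(2)] e[OF 3(3)] by (auto simp: s smult_r_distr intro!: restrict_ext)
  next case (4 a b f) then show ?case using e[OF 4(3)] by (auto simp: s smult_assoc intro!: restrict_ext)
  next case (5 f) then show ?case using e[OF 5] by (auto simp: s c smult_one PiE_def extensional_def fun_eq_iff)
  qed
qed

lemma (in ring) right_regular_right_module: "right_module R (right_regular R)"
proof -
  have "abelian_group (right_regular R)"
    by (rule abelian_groupI) (auto simp: right_regular_def a_ac intro: l_neg bexI[of _ "\<ominus> _"])
  then interpret D: abelian_group "right_regular R" .
  show ?thesis
    by unfold_locales (auto simp: right_regular_def l_distr r_distr m_assoc)
qed

end

theory Submission
  imports Defs
begin

text \<open>
  Let \<open>S\<close> be a simple left module. By Schur's lemma a nonzero functional on \<open>S\<close> is injective, so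
  it vanishes at no nonzero element of \<open>S\<close>. Hence, for a fixed \<open>s \<noteq> 0\<close> in \<open>S\<close>, evaluation
  at \<open>s\<close> is an injective homomorphism from \<open>S\<^sup>*\<close> to the right regular module, and \<open>S\<^sup>*\<close> is
  torsionless (\<open>simple_dual_torsionless\<close>).

  Now let \<open>S\<close> be reflexive too. Then every homomorphism from \<open>S\<^sup>*\<close> to \<open>A\<close> is the evaluation
  at some \<open>s \<in> S\<close>. If a nonzero factor module \<open>S\<^sup>*/U\<close> is torsionless, its elements are separated
  by homomorphisms to \<open>A\<close> (\<open>right_torsionless_separated\<close>), so there is a nonzero homomorphism
  \<open>S\<^sup>* \<rightarrow> A\<close> that kills \<open>U\<close>. It is the evaluation at some \<open>s \<noteq> 0\<close>, so all members of \<open>U\<close>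
  vanish at \<open>s\<close>, and \<open>U = 0\<close> by the first paragraph
  (\<open>simple_reflexive_dual_factor_not_torsionless\<close>).

  For the last claim one could observe that the image of a nonzero endomorphism of \<open>S\<^sup>*\<close> is a
  torsionless factor module, so that the endomorphism is injective, and then count dimensions.
  Reflexivity gives a more direct argument: every endomorphism \<open>\<phi>\<close> of \<open>S\<^sup>*\<close> is
  precomposition with an endomorphism \<open>\<psi>\<close> of \<open>S\<close> (\<open>reflexive_dual_endomorphism\<close>). If
  \<open>\<phi> \<noteq> 0\<close> then \<open>\<psi> \<noteq> 0\<close>, so \<open>\<psi>\<close> is bijective by Schur's lemma, and
  precomposition with its inverse inverts \<open>\<phi>\<close>.
\<close>

section \<open>Homomorphisms of one-sided modules\<close>

lemma mod_homD:
  assumes "f \<in> mod_hom A M N"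
  shows mod_hom_closed: "x \<in> carrier M \<Longrightarrow> f x \<in> carrier N"
    and mod_hom_add: "\<lbrakk>x \<in> carrier M; y \<in> carrier M\<rbrakk> \<Longrightarrow> f (x \<oplus>\<^bsub>M\<^esub> y) = f x \<oplus>\<^bsub>N\<^esub> f y"
    and mod_hom_smult: "\<lbrakk>a \<in> carrier A; x \<in> carrier M\<rbrakk> \<Longrightarrow> f (a \<odot>\<^bsub>M\<^esub> x) = a \<odot>\<^bsub>N\<^esub> f x"
    and mod_hom_extensional: "f \<in> extensional (carrier M)"
  using assms by (auto simp: mod_hom_def PiE_def)

lemma mod_homI:
  assumes "\<And>x. x \<in> carrier M \<Longrightarrow> f x \<in> carrier N"
    and "\<And>x y. \<lbrakk>x \<in> carrier M; y \<in> carrier M\<rbrakk> \<Longrightarrow> f (x \<oplus>\<^bsub>M\<^esub> y) = f x \<oplus>\<^bsub>N\<^esub> f y"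
    and "\<And>a x. \<lbrakk>a \<in> carrier A; x \<in> carrier M\<rbrakk> \<Longrightarrow> f (a \<odot>\<^bsub>M\<^esub> x) = a \<odot>\<^bsub>N\<^esub> f x"
    and "f \<in> extensional (carrier M)"
  shows "f \<in> mod_hom A M N"
  using assms by (auto simp: mod_hom_def PiE_def)

lemma mod_hom_abelian_group_hom:
  assumes "abelian_group M" "abelian_group N" "f \<in> mod_hom A M N"
  shows "abelian_group_hom M N f"
  using assms
  by (auto intro!: abelian_group_homI abelian_group.a_group group_hom.intro group_hom_axioms.intro
      simp: hom_def mod_hom_closed mod_hom_add)

lemma mod_hom_zero:
  assumes "abelian_group M" "abelian_group N" "f \<in> mod_hom A M N"
  shows "f \<zero>\<^bsub>M\<^esub> = \<zero>\<^bsub>N\<^esub>"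
  using abelian_group_hom.hom_zero[OF mod_hom_abelian_group_hom[OF assms]] .

text \<open>
  The two module axioms that left and right modules share in the same form and that kernels,
  images, composites and inverses of homomorphisms depend on; proving these facts here covers
  both sides at once.
\<close>

locale acted_group = abelian_group M
  for A :: "('a, 'l) ring_scheme" and M :: "('a, 'b, 'n) module_scheme" (structure) +
  assumes act_closed: "\<lbrakk>a \<in> carrier A; x \<in> carrier M\<rbrakk> \<Longrightarrow> a \<odot> x \<in> carrier M"
    and act_distr: "\<lbrakk>a \<in> carrier A; x \<in> carrier M; y \<in> carrier M\<rbrakk>
      \<Longrightarrow> a \<odot> (x \<oplus> y) = a \<odot> x \<oplus> a \<odot> y"

sublocale left_module \<subseteq> acted_group A M
  by unfold_locales (rule smult_closed, assumption+, rule smult_r_distr)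

sublocale right_module \<subseteq> acted_group A M
  by unfold_locales (rule smult_closed, assumption+, rule smult_r_distr)

context acted_group
begin

lemma act_zero:
  assumes "a \<in> carrier A" shows "a \<odot> \<zero> = \<zero>"
proof -
  have "a \<odot> \<zero> \<oplus> a \<odot> \<zero> = a \<odot> \<zero> \<oplus> \<zero>"
    using act_distr[OF assms, of \<zero> \<zero>] act_closed[OF assms] by simp
  then show ?thesis using act_closed[OF assms] by (simp only: add.l_cancel zero_closed)
qed

lemma mod_hom_compose:
  assumes f: "f \<in> mod_hom A M N" and g: "g \<in> mod_hom A N L"
  shows "compose (carrier M) g f \<in> mod_hom A M L"
  using mod_homD[OF f] mod_homD[OF g]
  by (intro mod_homI) (auto simp: compose_def act_closed)

lemma mod_hom_inverse:
  assumes f: "f \<in> mod_hom A M N" and bij: "bij_betw f (carrier M) (carrier N)"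
  shows "(\<lambda>y\<in>carrier N. inv_into (carrier M) f y) \<in> mod_hom A N M" (is "?g \<in> _")
proof -
  have inj: "inj_on f (carrier M)" and im: "carrier N = f ` carrier M"
    using bij by (auto simp: bij_betw_def)
  have gf: "?g (f x) = x" if "x \<in> carrier M" for x
    using that inj im by simp
  have addf: "f x \<oplus>\<^bsub>N\<^esub> f y = f (x \<oplus> y)" if "x \<in> carrier M" "y \<in> carrier M" for x y
    using mod_hom_add[OF f that] by simp
  have smf: "a \<odot>\<^bsub>N\<^esub> f x = f (a \<odot> x)" if "a \<in> carrier A" "x \<in> carrier M" for a x
    using mod_hom_smult[OF f that] by simp
  show ?thesis
  proof (rule mod_homI)
    fix x y assume "x \<in> carrier N" "y \<in> carrier N"
    then obtain u v where "u \<in> carrier M" "v \<in> carrier M" "x = f u" "y = f v"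
      using im by blast
    then show "?g (x \<oplus>\<^bsub>N\<^esub> y) = ?g x \<oplus> ?g y"
      by (simp only: addf gf add.m_closed)
  next
    fix a x assume "a \<in> carrier A" "x \<in> carrier N"
    moreover from this obtain u where "u \<in> carrier M" "x = f u" using im by blast
    ultimately show "?g (a \<odot>\<^bsub>N\<^esub> x) = a \<odot> ?g x"
      by (simp only: smf gf act_closed)
  next
    fix x assume "x \<in> carrier N"
    then show "?g x \<in> carrier M" using im by (auto simp: inv_into_into)
  qed auto
qed

lemma submodule_image:
  assumes N: "abelian_group N" and f: "f \<in> mod_hom A M N"
  shows "submodule (f ` carrier M) A N"
proof -
  interpret f: abelian_group_hom M N f
    by (rule mod_hom_abelian_group_hom[OF abelian_group_axioms N f])
  have "subgroup (f ` carrier M) (add_monoid N)"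
    using group_hom.img_is_subgroup[OF f.a_group_hom] by simp
  moreover have "a \<odot>\<^bsub>N\<^esub> y \<in> f ` carrier M" if "a \<in> carrier A" "y \<in> f ` carrier M" for a y
    using that mod_hom_smult[OF f] act_closed by (metis (no_types, lifting) image_iff)
  ultimately show ?thesis
    by (intro submodule.intro submodule_axioms.intro)
qed

lemma submodule_kernel:
  assumes N: "acted_group A N" and f: "f \<in> mod_hom A M N"
  shows "submodule {x \<in> carrier M. f x = \<zero>\<^bsub>N\<^esub>} A M"
proof -
  interpret N: acted_group A N by fact
  interpret f: abelian_group_hom M N f
    by (rule mod_hom_abelian_group_hom[OF abelian_group_axioms N.abelian_group_axioms f])
  have "subgroup {x \<in> carrier M. f x = \<zero>\<^bsub>N\<^esub>} (add_monoid M)"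
    using group_hom.subgroup_kernel[OF f.a_group_hom] by (simp add: kernel_def)
  then show ?thesis
    by (intro submodule.intro submodule_axioms.intro)
      (auto simp: mod_hom_smult[OF f] act_closed N.act_zero)
qed

lemma mod_hom_inj_onI:
  assumes N: "abelian_group N" and f: "f \<in> mod_hom A M N"
    and ker: "\<And>x. \<lbrakk>x \<in> carrier M; f x = \<zero>\<^bsub>N\<^esub>\<rbrakk> \<Longrightarrow> x = \<zero>"
  shows "inj_on f (carrier M)"
proof -
  interpret f: abelian_group_hom M N f
    by (rule mod_hom_abelian_group_hom[OF abelian_group_axioms N f])
  show ?thesis
    using group_hom.inj_on_one_iff[OF f.a_group_hom] ker by simp
qed

end

section \<open>Schur's lemma\<close>

lemma simple_mod_hom_inj:
  assumes S: "simple_left_module A S" and N: "left_module A N" and f: "f \<in> mod_hom A S N"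
    and nz: "x \<in> carrier S" "f x \<noteq> \<zero>\<^bsub>N\<^esub>"
  shows "inj_on f (carrier S)"
proof -
  interpret S: left_module A S using S by (simp add: simple_left_module_def)
  interpret N: left_module A N by fact
  have "submodule {x \<in> carrier S. f x = \<zero>\<^bsub>N\<^esub>} A S"
    by (rule S.submodule_kernel[OF N.acted_group_axioms f])
  then have "{x \<in> carrier S. f x = \<zero>\<^bsub>N\<^esub>} = {\<zero>\<^bsub>S\<^esub>}"
    using S nz unfolding simple_left_module_def by blast
  then show ?thesis
    by (intro S.mod_hom_inj_onI[OF N.abelian_group_axioms f]) blast
qed

lemma simple_endomorphism_bij:
  assumes S: "simple_left_module A S" and f: "f \<in> mod_hom A S S"
    and nz: "x \<in> carrier S" "f x \<noteq> \<zero>\<^bsub>S\<^esub>"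
  shows "bij_betw f (carrier S) (carrier S)"
proof -
  interpret S: left_module A S using S by (simp add: simple_left_module_def)
  have "f ` carrier S = carrier S"
    using S.submodule_image[OF S.abelian_group_axioms f] S nz
    unfolding simple_left_module_def by blast
  then show ?thesis
    using simple_mod_hom_inj[OF S S.left_module_axioms f nz] by (simp add: bij_betw_def)
qed

section \<open>Functionals and evaluation\<close>

lemma (in ring) left_regular_left_module: "left_module R (left_regular R)"
proof -
  have "abelian_group (left_regular R)"
    by (rule abelian_groupI) (auto simp: left_regular_def a_ac intro: l_neg bexI[of _ "\<ominus> _"])
  then interpret D: abelian_group "left_regular R" .
  show ?thesis
    by unfold_locales (auto simp: left_regular_def l_distr r_distr m_assoc)
qed

lemma left_dual_simps:
  "carrier (left_dual A M) = mod_hom A M (left_regular A)"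
  "\<zero>\<^bsub>left_dual A M\<^esub> = (\<lambda>x\<in>carrier M. \<zero>\<^bsub>A\<^esub>)"
  "f \<oplus>\<^bsub>left_dual A M\<^esub> g = (\<lambda>x\<in>carrier M. f x \<oplus>\<^bsub>A\<^esub> g x)"
  "a \<odot>\<^bsub>left_dual A M\<^esub> f = (\<lambda>x\<in>carrier M. f x \<otimes>\<^bsub>A\<^esub> a)"
  by (simp_all add: left_dual_def)

lemma left_regular_simps:
  "carrier (left_regular A) = carrier A" "\<zero>\<^bsub>left_regular A\<^esub> = \<zero>\<^bsub>A\<^esub>"
  "x \<oplus>\<^bsub>left_regular A\<^esub> y = x \<oplus>\<^bsub>A\<^esub> y" "a \<odot>\<^bsub>left_regular A\<^esub> x = a \<otimes>\<^bsub>A\<^esub> x"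
  by (simp_all add: left_regular_def)

lemma right_regular_simps:
  "carrier (right_regular A) = carrier A" "\<zero>\<^bsub>right_regular A\<^esub> = \<zero>\<^bsub>A\<^esub>"
  "x \<oplus>\<^bsub>right_regular A\<^esub> y = x \<oplus>\<^bsub>A\<^esub> y" "a \<odot>\<^bsub>right_regular A\<^esub> x = x \<otimes>\<^bsub>A\<^esub> a"
  by (simp_all add: right_regular_def)

lemma direct_power_simps:
  "carrier (direct_power n M) = {..<n} \<rightarrow>\<^sub>E carrier M"
  "\<zero>\<^bsub>direct_power n M\<^esub> = (\<lambda>i\<in>{..<n}. \<zero>\<^bsub>M\<^esub>)"
  "x \<oplus>\<^bsub>direct_power n M\<^esub> y = (\<lambda>i\<in>{..<n}. x i \<oplus>\<^bsub>M\<^esub> y i)"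
  "a \<odot>\<^bsub>direct_power n M\<^esub> x = (\<lambda>i\<in>{..<n}. a \<odot>\<^bsub>M\<^esub> x i)"
  by (simp_all add: direct_power_def)

lemma left_dual_eqI:
  assumes "f \<in> carrier (left_dual A M)" "g \<in> carrier (left_dual A M)"
    and "\<And>x. x \<in> carrier M \<Longrightarrow> f x = g x"
  shows "f = g"
  using assms mod_hom_extensional by (metis extensionalityI left_dual_simps(1))

text \<open>
  The two halves of reflexivity. Surjectivity of the evaluation map represents functionals on the
  dual by points of the module; injectivity says that functionals separate points, which
  turns identities in the module into identities in \<open>A\<close>.
\<close>

lemma left_reflexive_functional:
  assumes "left_reflexive A M" and "h \<in> mod_hom A (left_dual A M) (right_regular A)"
  obtains m where "m \<in> carrier M" "\<And>f. f \<in> carrier (left_dual A M) \<Longrightarrow> h f = f m"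
proof -
  have "h \<in> left_eval_map A M ` carrier M"
    using assms by (simp add: left_reflexive_def bij_betw_def right_dual_def)
  then obtain m where "m \<in> carrier M" "h = left_eval_map A M m" by blast
  then show thesis by (intro that[of m]) (auto simp: left_eval_map_def)
qed

lemma left_reflexive_separated:
  assumes "left_reflexive A M" "x \<in> carrier M" "y \<in> carrier M"
    and "\<And>f. f \<in> carrier (left_dual A M) \<Longrightarrow> f x = f y"
  shows "x = y"
proof -
  have "inj_on (left_eval_map A M) (carrier M)"
    using assms(1) by (simp add: left_reflexive_def bij_betw_def)
  moreover have "left_eval_map A M x = left_eval_map A M y"
    using assms by (auto simp: left_eval_map_def intro!: restrict_ext)
  ultimately show ?thesis using assms(2,3) by (auto dest: inj_onD)
qed

section \<open>Torsionless right modules\<close>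

lemma direct_power_regular_projective:
  assumes "ring A"
  shows "right_projective A (direct_power n (right_regular A))"
proof -
  interpret ring A by fact
  interpret R: right_module A "right_regular A" by (rule right_regular_right_module)
  let ?F = "direct_power n (right_regular A)"
  interpret F: right_module A ?F by (rule R.direct_power_right_module)
  have id: "(\<lambda>x\<in>carrier ?F. x) \<in> mod_hom A ?F ?F"
    by (rule mod_homI) (auto simp: F.act_closed)
  have "submodule (carrier ?F) A ?F"
    using F.submodule_image[OF F.abelian_group_axioms id] by simp
  moreover have zero: "(\<lambda>x\<in>carrier ?F. \<zero>\<^bsub>?F\<^esub>) \<in> mod_hom A ?F ?F"
    by (rule mod_homI) (auto simp: F.act_closed direct_power_simps right_regular_simps intro!: restrict_ext)
  have "(\<lambda>x\<in>carrier ?F. \<zero>\<^bsub>?F\<^esub>) ` carrier ?F = {\<zero>\<^bsub>?F\<^esub>}"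
    using F.zero_closed by (force simp: image_iff)
  then have "submodule {\<zero>\<^bsub>?F\<^esub>} A ?F"
    using F.submodule_image[OF F.abelian_group_axioms zero] by simp
  moreover have "carrier ?F \<inter> {\<zero>\<^bsub>?F\<^esub>} = {\<zero>\<^bsub>?F\<^esub>}" by auto
  moreover have "carrier ?F <+>\<^bsub>?F\<^esub> {\<zero>\<^bsub>?F\<^esub>} = carrier ?F"
    by (auto simp: set_add_defs)
  moreover have "mod_isomorphic A ?F (?F\<lparr>carrier := carrier ?F\<rparr>)"
    using id by (auto simp: mod_isomorphic_def bij_betw_def inj_on_def intro!: bexI[of _ "\<lambda>x\<in>carrier ?F. x"])
  ultimately show ?thesis
    unfolding right_projective_def Let_def using F.right_module_axioms by blast
qed

text \<open>
  A module that embeds into the regular module is torsionless: the free module of rank one is the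
  required projective module.
\<close>

lemma right_torsionlessI:
  assumes N: "right_module A N" and g: "g \<in> mod_hom A N (right_regular A)"
    and inj: "inj_on g (carrier N)"
  shows "right_torsionless A N"
proof -
  interpret N: right_module A N by fact
  interpret R: right_module A "right_regular A" by (rule N.A.right_regular_right_module)
  let ?F = "direct_power 1 (right_regular A)"
  interpret F: right_module A ?F by (rule R.direct_power_right_module)
  define h where "h = (\<lambda>x\<in>carrier N. \<lambda>i\<in>{..<1::nat}. g x)"
  have h: "h \<in> mod_hom A N ?F"
    using mod_homD[OF g]
    by (intro mod_homI) (auto simp: h_def direct_power_simps N.act_closed intro!: restrict_ext)
  have "inj_on h (carrier N)"
  proof (rule inj_onI)
    fix x y assume xy: "x \<in> carrier N" "y \<in> carrier N" "h x = h y"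
    then have "h x 0 = h y 0" by simp
    then show "x = y" using xy inj by (auto simp: h_def dest: inj_onD)
  qed
  moreover have "h \<in> mod_hom A N (?F\<lparr>carrier := h ` carrier N\<rparr>)"
    using mod_homD[OF h] by (intro mod_homI) auto
  ultimately have "mod_isomorphic A N (?F\<lparr>carrier := h ` carrier N\<rparr>)"
    unfolding mod_isomorphic_def bij_betw_def by auto
  then show ?thesis
    unfolding right_torsionless_def
    using N direct_power_regular_projective[OF N.A.ring_axioms]
      N.submodule_image[OF F.abelian_group_axioms h] by blast
qed

lemma mod_hom_carrier_mono:
  assumes "f \<in> mod_hom A M (N\<lparr>carrier := U\<rparr>)" "U \<subseteq> carrier N"
  shows "f \<in> mod_hom A M N"
  using mod_homD[OF assms(1)] assms(2) by (intro mod_homI) auto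

lemma submodule_subset: "submodule U A M \<Longrightarrow> U \<subseteq> carrier M"
  by (auto dest!: submodule.axioms(1) subgroup.subset)

text \<open>
  The converse direction in its useful form. A torsionless module embeds into a projective module
  and hence into some \<open>A\<^sup>n\<close>; two distinct elements have images that differ in
  some coordinate, and the projection to that coordinate is a homomorphism to \<open>A\<close>.
\<close>

lemma right_torsionless_separated:
  assumes N: "right_torsionless A N" and xy: "x \<in> carrier N" "y \<in> carrier N" "x \<noteq> y"
  obtains g where "g \<in> mod_hom A N (right_regular A)" "g x \<noteq> g y"
proof -
  interpret N: right_module A N using N by (simp add: right_torsionless_def)
  obtain P :: "('a, nat \<Rightarrow> 'a) module" and U where P: "right_projective A P"
    and U: "submodule U A P" and NU: "mod_isomorphic A N (P\<lparr>carrier := U\<rparr>)"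
    using N by (auto simp: right_torsionless_def)
  obtain n V where V: "submodule V A (direct_power n (right_regular A))"
    and PV: "mod_isomorphic A P ((direct_power n (right_regular A))\<lparr>carrier := V\<rparr>)"
    using P unfolding right_projective_def Let_def by blast
  let ?F = "direct_power n (right_regular A)"
  obtain f where f: "f \<in> mod_hom A N (P\<lparr>carrier := U\<rparr>)" and "inj_on f (carrier N)"
    using NU by (auto simp: mod_isomorphic_def bij_betw_def)
  have f': "f \<in> mod_hom A N P"
    by (rule mod_hom_carrier_mono[OF f submodule_subset[OF U]])
  obtain g where g: "g \<in> mod_hom A P (?F\<lparr>carrier := V\<rparr>)" and "inj_on g (carrier P)"
    using PV by (auto simp: mod_isomorphic_def bij_betw_def)
  have g': "g \<in> mod_hom A P ?F"
    by (rule mod_hom_carrier_mono[OF g submodule_subset[OF V]])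
  have "f x \<noteq> f y" using \<open>inj_on f _\<close> xy by (auto dest: inj_onD)
  then have ne: "g (f x) \<noteq> g (f y)"
    using \<open>inj_on g _\<close> xy mod_hom_closed[OF f'] by (auto dest: inj_onD)
  have "g (f z) \<in> {..<n} \<rightarrow>\<^sub>E carrier A" if "z \<in> carrier N" for z
    using mod_hom_closed[OF g' mod_hom_closed[OF f' that]]
    by (simp add: direct_power_simps right_regular_simps)
  then obtain i where i: "i < n" "g (f x) i \<noteq> g (f y) i"
    using ne xy by (metis PiE_ext lessThan_iff)
  have pr: "(\<lambda>v\<in>carrier ?F. v i) \<in> mod_hom A ?F (right_regular A)"
  proof -
    interpret R: right_module A "right_regular A" by (rule N.A.right_regular_right_module)
    interpret F: right_module A ?F by (rule R.direct_power_right_module)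
    show ?thesis
    proof (rule mod_homI)
      fix u v assume uv: "u \<in> carrier ?F" "v \<in> carrier ?F"
      show "(\<lambda>v\<in>carrier ?F. v i) (u \<oplus>\<^bsub>?F\<^esub> v)
        = (\<lambda>v\<in>carrier ?F. v i) u \<oplus>\<^bsub>right_regular A\<^esub> (\<lambda>v\<in>carrier ?F. v i) v"
        using uv F.add.m_closed[OF uv] i by (simp add: direct_power_simps(3))
    next
      fix a u assume au: "a \<in> carrier A" "u \<in> carrier ?F"
      show "(\<lambda>v\<in>carrier ?F. v i) (a \<odot>\<^bsub>?F\<^esub> u)
        = a \<odot>\<^bsub>right_regular A\<^esub> (\<lambda>v\<in>carrier ?F. v i) u"
        using au F.act_closed[OF au] i by (simp add: direct_power_simps(4))
    qed (use i in \<open>auto simp: direct_power_simps\<close>)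
  qed
  show thesis
  proof (rule that)
    show "compose (carrier N) (\<lambda>v\<in>carrier ?F. v i) (compose (carrier N) g f)
      \<in> mod_hom A N (right_regular A)"
      by (intro N.mod_hom_compose[OF _ pr] N.mod_hom_compose[OF f' g'])
    show "compose (carrier N) (\<lambda>v\<in>carrier ?F. v i) (compose (carrier N) g f) x
      \<noteq> compose (carrier N) (\<lambda>v\<in>carrier ?F. v i) (compose (carrier N) g f) y"
      using xy i mod_hom_closed[OF g'] mod_hom_closed[OF f'] by (simp add: compose_def)
  qed
qed

lemma (in right_module) factor_map_mod_hom:
  assumes U: "submodule U A M"
  shows "(\<lambda>x\<in>carrier M. U +> x) \<in> mod_hom A M (factor_module M U)"
proof -
  interpret U: submodule U A M by fact
  have "abelian_subgroup U M"
    by (rule abelian_subgroupI3)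
      (auto intro: additive_subgroup.intro U.subgroup_axioms abelian_group_axioms)
  then interpret U: abelian_subgroup U M .
  show ?thesis
  proof (rule mod_homI)
    fix a x assume a: "a \<in> carrier A" and x: "x \<in> carrier M"
    \<comment> \<open>The action on a coset is a union over all its representatives \<open>z\<close>; each contributes
      the same coset.\<close>
    have "U +> (a \<odot> z) = U +> (a \<odot> x)" if z: "z \<in> U +> x" for z
    proof -
      obtain u where u: "u \<in> U" "z = u \<oplus> x"
        using z by (auto simp: a_r_coset_def r_coset_def)
      then have "a \<odot> z = a \<odot> u \<oplus> a \<odot> x"
        using a x U.a_subset smult_r_distr by auto
      then have "a \<odot> z \<in> U +> (a \<odot> x)"
        using u(1) a by (auto simp: a_r_coset_def r_coset_def)
      then show ?thesis using a_repr_independence[OF _ act_closed[OF a x] U.a_subgroup] by simp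
    qed
    then have "(\<Union>z\<in>U +> x. U +> (a \<odot> z)) = U +> (a \<odot> x)"
      using U.a_rcos_self[OF x] by blast
    then show "(\<lambda>x\<in>carrier M. U +> x) (a \<odot> x)
      = a \<odot>\<^bsub>factor_module M U\<^esub> (\<lambda>x\<in>carrier M. U +> x) x"
      using act_closed[OF a x] x by (simp add: factor_module_def)
  next
    fix x assume "x \<in> carrier M"
    then show "(\<lambda>x\<in>carrier M. U +> x) x \<in> carrier (factor_module M U)"
      by (auto simp: factor_module_def A_RCOSETS_defs a_r_coset_def r_coset_def)
  qed (simp_all add: factor_module_def U.a_rcos_sum)
qed

section \<open>Endomorphism rings\<close>

lemma (in right_module) endomorphism_ring_ring: "ring (endomorphism_ring A M)"
proof -
  let ?E = "endomorphism_ring A M"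
  have s: "carrier ?E = mod_hom A M M" "\<zero>\<^bsub>?E\<^esub> = (\<lambda>x\<in>carrier M. \<zero>)"
    "f \<oplus>\<^bsub>?E\<^esub> g = (\<lambda>x\<in>carrier M. f x \<oplus> g x)" "f \<otimes>\<^bsub>?E\<^esub> g = compose (carrier M) f g"
    "\<one>\<^bsub>?E\<^esub> = (\<lambda>x\<in>carrier M. x)" for f g
    by (simp_all add: endomorphism_ring_def)
  have neg: "a \<odot> (\<ominus> x) = \<ominus> (a \<odot> x)" if "a \<in> carrier A" "x \<in> carrier M" for a x
    using smult_r_distr[of a "\<ominus> x" x] that by (metis a_inv_closed l_neg act_closed minus_equality act_zero)
  have restr: "restrict f (carrier M) = f" if "f \<in> mod_hom A M M" for f
    using mod_hom_extensional[OF that] by (simp add: extensional_restrict)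
  show ?thesis
  proof (rule ringI)
    show "abelian_group ?E"
    proof (rule abelian_groupI, unfold s)
      fix f g assume f: "f \<in> mod_hom A M M" and g: "g \<in> mod_hom A M M"
      note D = mod_homD[OF f] mod_homD[OF g]
      show "(\<lambda>x\<in>carrier M. f x \<oplus> g x) \<in> mod_hom A M M"
        by (rule mod_homI) (auto simp: D act_closed a_ac smult_r_distr)
      show "(\<lambda>x\<in>carrier M. f x \<oplus> g x) = (\<lambda>x\<in>carrier M. g x \<oplus> f x)"
        by (auto simp: D a_comm intro!: restrict_ext)
      fix h assume h: "h \<in> mod_hom A M M"
      show "(\<lambda>x\<in>carrier M. (\<lambda>x\<in>carrier M. f x \<oplus> g x) x \<oplus> h x)
        = (\<lambda>x\<in>carrier M. f x \<oplus> (\<lambda>x\<in>carrier M. g x \<oplus> h x) x)"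
        by (auto simp: D mod_homD[OF h] a_assoc intro!: restrict_ext)
    next
      show "(\<lambda>x\<in>carrier M. \<zero>) \<in> mod_hom A M M"
        by (rule mod_homI) (auto simp: act_zero act_closed)
      fix f assume f: "f \<in> mod_hom A M M"
      note D = mod_homD[OF f]
      have "(\<lambda>x\<in>carrier M. (\<lambda>x\<in>carrier M. \<zero>) x \<oplus> f x) = restrict f (carrier M)"
        by (auto simp: D intro!: restrict_ext)
      then show "(\<lambda>x\<in>carrier M. (\<lambda>x\<in>carrier M. \<zero>) x \<oplus> f x) = f"
        by (simp add: restr f)
      show "\<exists>g\<in>mod_hom A M M. (\<lambda>x\<in>carrier M. g x \<oplus> f x) = (\<lambda>x\<in>carrier M. \<zero>)"
      proof
        show "(\<lambda>x\<in>carrier M. \<ominus> f x) \<in> mod_hom A M M"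
          by (rule mod_homI) (auto simp: D act_closed neg minus_add)
        show "(\<lambda>x\<in>carrier M. (\<lambda>x\<in>carrier M. \<ominus> f x) x \<oplus> f x) = (\<lambda>x\<in>carrier M. \<zero>)"
          by (auto simp: D l_neg intro!: restrict_ext)
      qed
    qed
  next
    show "monoid ?E"
    proof (rule monoidI, unfold s)
      show "(\<lambda>x\<in>carrier M. x) \<in> mod_hom A M M"
        by (rule mod_homI) (auto simp: act_closed)
    next
      fix f g assume f: "f \<in> mod_hom A M M" and g: "g \<in> mod_hom A M M"
      show "compose (carrier M) f g \<in> mod_hom A M M" by (rule mod_hom_compose[OF g f])
      fix h assume h: "h \<in> mod_hom A M M"
      show "compose (carrier M) (compose (carrier M) f g) h
        = compose (carrier M) f (compose (carrier M) g h)"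
        by (auto simp: compose_def mod_homD[OF h] intro!: restrict_ext)
    next
      fix f assume f: "f \<in> mod_hom A M M"
      have "compose (carrier M) (\<lambda>x\<in>carrier M. x) f = restrict f (carrier M)"
        "compose (carrier M) f (\<lambda>x\<in>carrier M. x) = restrict f (carrier M)"
        by (auto simp: compose_def mod_homD[OF f] intro!: restrict_ext)
      then show "compose (carrier M) (\<lambda>x\<in>carrier M. x) f = f"
        "compose (carrier M) f (\<lambda>x\<in>carrier M. x) = f"
        by (simp_all add: restr f)
    qed
  next
    fix f g h assume "f \<in> carrier ?E" "g \<in> carrier ?E" "h \<in> carrier ?E"
    then have D: "f \<in> mod_hom A M M" "g \<in> mod_hom A M M" "h \<in> mod_hom A M M"
      by (simp_all add: s)
    note D' = D(1)[THEN mod_homD(1)] D(2)[THEN mod_homD(1)] D(3)[THEN mod_homD(1)]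
      D(3)[THEN mod_homD(2)]
    show "(f \<oplus>\<^bsub>?E\<^esub> g) \<otimes>\<^bsub>?E\<^esub> h = f \<otimes>\<^bsub>?E\<^esub> h \<oplus>\<^bsub>?E\<^esub> g \<otimes>\<^bsub>?E\<^esub> h"
      by (auto simp: s compose_def D' intro!: restrict_ext)
    show "h \<otimes>\<^bsub>?E\<^esub> (f \<oplus>\<^bsub>?E\<^esub> g) = h \<otimes>\<^bsub>?E\<^esub> f \<oplus>\<^bsub>?E\<^esub> h \<otimes>\<^bsub>?E\<^esub> g"
      by (auto simp: s compose_def D' intro!: restrict_ext)
  qed
qed

text \<open>
  A nonzero endomorphism that is bijective is a unit of the endomorphism ring, because the inverse map
  is again a homomorphism. A nonzero module is what makes the ring nontrivial.
\<close>

lemma (in right_module) brickI: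
  assumes nz: "carrier M \<noteq> {\<zero>}"
    and bij: "\<And>f x. \<lbrakk>f \<in> mod_hom A M M; x \<in> carrier M; f x \<noteq> \<zero>\<rbrakk>
      \<Longrightarrow> bij_betw f (carrier M) (carrier M)"
  shows "brick A M"
proof -
  let ?E = "endomorphism_ring A M"
  interpret E: ring ?E by (rule endomorphism_ring_ring)
  have s: "carrier ?E = mod_hom A M M" "\<zero>\<^bsub>?E\<^esub> = (\<lambda>x\<in>carrier M. \<zero>)"
    "f \<otimes>\<^bsub>?E\<^esub> g = compose (carrier M) f g" "\<one>\<^bsub>?E\<^esub> = (\<lambda>x\<in>carrier M. x)" for f g
    by (simp_all add: endomorphism_ring_def)
  obtain m where m: "m \<in> carrier M" "m \<noteq> \<zero>" using nz zero_closed by blast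
  have one: "\<one>\<^bsub>?E\<^esub> \<noteq> \<zero>\<^bsub>?E\<^esub>"
  proof
    assume "\<one>\<^bsub>?E\<^esub> = \<zero>\<^bsub>?E\<^esub>"
    then have "\<one>\<^bsub>?E\<^esub> m = \<zero>\<^bsub>?E\<^esub> m" by simp
    then show False using m by (simp add: s)
  qed
  have unit: "f \<in> Units ?E" if f: "f \<in> carrier ?E" "f \<noteq> \<zero>\<^bsub>?E\<^esub>" for f
  proof -
    have fh: "f \<in> mod_hom A M M" using f by (simp add: s)
    have "\<exists>x\<in>carrier M. f x \<noteq> \<zero>"
      using f(2) mod_hom_extensional[OF fh] by (auto simp: s intro: extensionalityI)
    then have b: "bij_betw f (carrier M) (carrier M)" using bij[OF fh] by blast
    let ?g = "\<lambda>y\<in>carrier M. inv_into (carrier M) f y"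
    have "?g \<in> carrier ?E" using mod_hom_inverse[OF fh b] by (simp add: s)
    moreover have "?g \<otimes>\<^bsub>?E\<^esub> f = \<one>\<^bsub>?E\<^esub>"
      using compose_inv_into_id[OF b] by (simp add: s)
    moreover have "f \<otimes>\<^bsub>?E\<^esub> ?g = \<one>\<^bsub>?E\<^esub>"
      using compose_id_inv_into[of f "carrier M" "carrier M"] b by (simp add: s bij_betw_def)
    ultimately show ?thesis using f by (auto simp: Units_def)
  qed
  have "Units ?E = carrier ?E - {\<zero>\<^bsub>?E\<^esub>}"
  proof (intro equalityI subsetI)
    fix f assume "f \<in> Units ?E"
    then obtain g where "f \<in> carrier ?E" "g \<in> carrier ?E" "g \<otimes>\<^bsub>?E\<^esub> f = \<one>\<^bsub>?E\<^esub>"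
      by (auto simp: Units_def)
    then show "f \<in> carrier ?E - {\<zero>\<^bsub>?E\<^esub>}" using one by auto
  qed (use unit in auto)
  then show ?thesis
    unfolding brick_def by (intro skew_field.intro skew_field_axioms.intro E.ring_axioms one)
qed

section \<open>The dual of a simple reflexive module\<close>

text \<open>
  The form in which Schur's lemma enters below: a nonzero functional on a simple module is
  injective, so it has no zeros besides \<open>0\<close>.
\<close>

lemma simple_dual_apply_zero:
  assumes S: "simple_left_module A S" and f: "f \<in> carrier (left_dual A S)"
    and s: "s \<in> carrier S" "s \<noteq> \<zero>\<^bsub>S\<^esub>" "f s = \<zero>\<^bsub>A\<^esub>"
  shows "f = \<zero>\<^bsub>left_dual A S\<^esub>"
proof (rule ccontr)
  interpret S: left_module A S using S by (simp add: simple_left_module_def)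
  interpret R: left_module A "left_regular A" by (rule S.A.left_regular_left_module)
  interpret D: right_module A "left_dual A S" by (rule S.left_dual_right_module)
  have fh: "f \<in> mod_hom A S (left_regular A)" using f by (simp add: left_dual_simps)
  assume "f \<noteq> \<zero>\<^bsub>left_dual A S\<^esub>"
  then obtain x where "x \<in> carrier S" "f x \<noteq> \<zero>\<^bsub>left_regular A\<^esub>"
    using left_dual_eqI[OF f D.zero_closed] by (auto simp: left_dual_simps left_regular_simps)
  then have "inj_on f (carrier S)"
    by (rule simple_mod_hom_inj[OF S R.left_module_axioms fh])
  moreover have "f \<zero>\<^bsub>S\<^esub> = \<zero>\<^bsub>A\<^esub>"
    using mod_hom_zero[OF S.abelian_group_axioms R.abelian_group_axioms fh]
    by (simp add: left_regular_simps)
  ultimately show False using s S.zero_closed by (metis inj_onD)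
qed

lemma eval_mod_hom:
  assumes "left_module A S" "s \<in> carrier S"
  shows "(\<lambda>f\<in>carrier (left_dual A S). f s) \<in> mod_hom A (left_dual A S) (right_regular A)"
proof -
  interpret S: left_module A S by fact
  interpret D: right_module A "left_dual A S" by (rule S.left_dual_right_module)
  show ?thesis
  proof (rule mod_homI)
    fix f g assume fg: "f \<in> carrier (left_dual A S)" "g \<in> carrier (left_dual A S)"
    then show "(\<lambda>f\<in>carrier (left_dual A S). f s) (f \<oplus>\<^bsub>left_dual A S\<^esub> g) =
        (\<lambda>f\<in>carrier (left_dual A S). f s) f \<oplus>\<^bsub>right_regular A\<^esub> (\<lambda>f\<in>carrier (left_dual A S). f s) g"
      using D.add.m_closed[OF fg] assms(2) by (simp add: left_dual_simps(2-) right_regular_simps)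
  next
    fix a f assume af: "a \<in> carrier A" "f \<in> carrier (left_dual A S)"
    then show "(\<lambda>f\<in>carrier (left_dual A S). f s) (a \<odot>\<^bsub>left_dual A S\<^esub> f)
        = a \<odot>\<^bsub>right_regular A\<^esub> (\<lambda>f\<in>carrier (left_dual A S). f s) f"
      using D.act_closed[OF af] assms(2) by (simp add: left_dual_simps(2-) right_regular_simps)
  next
    fix f assume "f \<in> carrier (left_dual A S)"
    then show "(\<lambda>f\<in>carrier (left_dual A S). f s) f \<in> carrier (right_regular A)"
      using mod_hom_closed[of f A S "left_regular A"] assms(2)
      by (simp add: left_dual_simps left_regular_simps right_regular_simps)
  qed auto
qed

text \<open>
  Evaluation at any nonzero element of \<open>S\<close> embeds the dual into the regular module.
\<close>

lemma simple_dual_torsionless: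
  assumes S: "simple_left_module A S"
  shows "right_torsionless A (left_dual A S)"
proof -
  interpret S: left_module A S using S by (simp add: simple_left_module_def)
  interpret D: right_module A "left_dual A S" by (rule S.left_dual_right_module)
  interpret R: right_module A "right_regular A" by (rule S.A.right_regular_right_module)
  obtain s where s: "s \<in> carrier S" "s \<noteq> \<zero>\<^bsub>S\<^esub>"
    using S S.zero_closed unfolding simple_left_module_def by blast
  let ?e = "\<lambda>f\<in>carrier (left_dual A S). f s"
  have e: "?e \<in> mod_hom A (left_dual A S) (right_regular A)"
    by (rule eval_mod_hom[OF S.left_module_axioms s(1)])
  have "inj_on ?e (carrier (left_dual A S))"
    by (rule D.mod_hom_inj_onI[OF R.abelian_group_axioms e])
      (use simple_dual_apply_zero[OF S _ s] in \<open>simp add: right_regular_simps\<close>)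
  then show ?thesis by (rule right_torsionlessI[OF D.right_module_axioms e])
qed

text \<open>
  A torsionless nonzero factor by \<open>U\<close> yields a nonzero functional on the dual that kills \<open>U\<close>.
  By reflexivity this functional is an evaluation at some \<open>s\<close>. If \<open>U\<close> contains a
  nonzero \<open>u\<close>, then \<open>u s = 0\<close> forces \<open>s = 0\<close>, and the functional would be zero.
\<close>

lemma simple_reflexive_dual_factor_not_torsionless:
  assumes S: "simple_left_module A S" and refl: "left_reflexive A S"
    and U: "submodule U A (left_dual A S)"
    and nz: "U \<noteq> {\<zero>\<^bsub>left_dual A S\<^esub>}" and proper: "U \<noteq> carrier (left_dual A S)"
  shows "\<not> right_torsionless A (factor_module (left_dual A S) U)"
proof
  let ?D = "left_dual A S"
  assume T: "right_torsionless A (factor_module ?D U)"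
  interpret S: left_module A S using S by (simp add: simple_left_module_def)
  interpret R: left_module A "left_regular A" by (rule S.A.left_regular_left_module)
  interpret RR: right_module A "right_regular A" by (rule S.A.right_regular_right_module)
  interpret D: right_module A ?D by (rule S.left_dual_right_module)
  interpret Q: right_module A "factor_module ?D U" by (rule D.factor_module_right_module[OF U])
  interpret U: submodule U A ?D by fact
  let ?p = "\<lambda>f\<in>carrier ?D. U +>\<^bsub>?D\<^esub> f"
  have p: "?p \<in> mod_hom A ?D (factor_module ?D U)" by (rule D.factor_map_mod_hom[OF U])
  have UD: "U \<subseteq> carrier ?D" by (rule submodule_subset[OF U])
  obtain f where f: "f \<in> carrier ?D" "f \<notin> U" using UD proper by blast
  have pU: "?p u = \<zero>\<^bsub>factor_module ?D U\<^esub>" if "u \<in> U" for u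
    using that UD D.a_coset_join2[OF _ U.subgroup_axioms] by (auto simp: factor_module_def)
  have pf: "?p f \<noteq> \<zero>\<^bsub>factor_module ?D U\<^esub>"
    using f D.a_coset_join1[OF _ _ U.subgroup_axioms] by (auto simp: factor_module_def)
  obtain g where g: "g \<in> mod_hom A (factor_module ?D U) (right_regular A)"
    and gf: "g (?p f) \<noteq> g \<zero>\<^bsub>factor_module ?D U\<^esub>"
    using right_torsionless_separated[OF T mod_hom_closed[OF p f(1)] Q.zero_closed pf] by blast
  have g0: "g \<zero>\<^bsub>factor_module ?D U\<^esub> = \<zero>\<^bsub>A\<^esub>"
    using mod_hom_zero[OF Q.abelian_group_axioms RR.abelian_group_axioms g]
    by (simp add: right_regular_simps)
  obtain s where s: "s \<in> carrier S"
    and ev: "\<And>h. h \<in> carrier ?D \<Longrightarrow> compose (carrier ?D) g ?p h = h s"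
    using left_reflexive_functional[OF refl D.mod_hom_compose[OF p g]] by blast
  obtain u where u: "u \<in> U" "u \<noteq> \<zero>\<^bsub>?D\<^esub>"
    using nz U.one_closed by auto
  have "u s = \<zero>\<^bsub>A\<^esub>" using ev[of u] u UD pU[OF u(1)] g0 by (auto simp: compose_def)
  then have "s = \<zero>\<^bsub>S\<^esub>" using simple_dual_apply_zero[OF S _ s] u UD by blast
  moreover have "f \<zero>\<^bsub>S\<^esub> = \<zero>\<^bsub>A\<^esub>"
    using mod_hom_zero[OF S.abelian_group_axioms R.abelian_group_axioms] f(1)
    by (simp add: left_dual_simps left_regular_simps)
  ultimately have "g (?p f) = \<zero>\<^bsub>A\<^esub>" using ev[OF f(1)] f(1) by (simp add: compose_def)
  then show False using gf g0 by simp
qed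

text \<open>
  For each \<open>s\<close> the map \<open>f \<mapsto> \<phi> f s\<close> is a functional on the dual, so it is the evaluation
  at a point, and \<open>\<psi> s\<close> is that point. The map \<open>\<psi>\<close> is a homomorphism because functionals
  separate points and \<open>\<phi> f\<close> is linear for every \<open>f\<close>.
\<close>

lemma reflexive_dual_endomorphism:
  assumes refl: "left_reflexive A S" and \<phi>: "\<phi> \<in> mod_hom A (left_dual A S) (left_dual A S)"
  obtains \<psi> where "\<psi> \<in> mod_hom A S S"
    and "\<And>f s. \<lbrakk>f \<in> carrier (left_dual A S); s \<in> carrier S\<rbrakk> \<Longrightarrow> \<phi> f s = f (\<psi> s)"
proof -
  let ?D = "left_dual A S"
  interpret S: left_module A S using refl by (simp add: left_reflexive_def)
  interpret D: right_module A ?D by (rule S.left_dual_right_module)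
  have hom: "f \<in> mod_hom A S (left_regular A)" if "f \<in> carrier ?D" for f
    using that by (simp add: left_dual_simps)
  have "\<exists>t\<in>carrier S. \<forall>f\<in>carrier ?D. \<phi> f s = f t" if s: "s \<in> carrier S" for s
  proof -
    have "compose (carrier ?D) (\<lambda>f\<in>carrier ?D. f s) \<phi> \<in> mod_hom A ?D (right_regular A)"
      by (rule D.mod_hom_compose[OF \<phi> eval_mod_hom[OF S.left_module_axioms s]])
    then obtain t where "t \<in> carrier S"
      "\<And>f. f \<in> carrier ?D \<Longrightarrow> compose (carrier ?D) (\<lambda>f\<in>carrier ?D. f s) \<phi> f = f t"
      using left_reflexive_functional[OF refl] by blast
    then show ?thesis using mod_hom_closed[OF \<phi>] by (auto simp: compose_def)
  qed
  then obtain q where q: "\<And>s. s \<in> carrier S \<Longrightarrow> q s \<in> carrier S"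
    "\<And>s f. \<lbrakk>s \<in> carrier S; f \<in> carrier ?D\<rbrakk> \<Longrightarrow> f (q s) = \<phi> f s"
    by metis
  have "restrict q (carrier S) \<in> mod_hom A S S"
  proof (rule mod_homI)
    fix s t assume st: "s \<in> carrier S" "t \<in> carrier S"
    have "q (s \<oplus>\<^bsub>S\<^esub> t) = q s \<oplus>\<^bsub>S\<^esub> q t"
    proof (rule left_reflexive_separated[OF refl])
      fix f assume f: "f \<in> carrier ?D"
      note f' = mod_homD[OF hom[OF f]] and pf = mod_homD[OF hom[OF mod_hom_closed[OF \<phi> f]]]
      show "f (q (s \<oplus>\<^bsub>S\<^esub> t)) = f (q s \<oplus>\<^bsub>S\<^esub> q t)"
        using st f by (simp add: q f' pf)
    qed (use st q in auto)
    then show "restrict q (carrier S) (s \<oplus>\<^bsub>S\<^esub> t)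
      = restrict q (carrier S) s \<oplus>\<^bsub>S\<^esub> restrict q (carrier S) t"
      using st by simp
  next
    fix a s assume as: "a \<in> carrier A" "s \<in> carrier S"
    have "q (a \<odot>\<^bsub>S\<^esub> s) = a \<odot>\<^bsub>S\<^esub> q s"
    proof (rule left_reflexive_separated[OF refl])
      fix f assume f: "f \<in> carrier ?D"
      note f' = mod_homD[OF hom[OF f]] and pf = mod_homD[OF hom[OF mod_hom_closed[OF \<phi> f]]]
      show "f (q (a \<odot>\<^bsub>S\<^esub> s)) = f (a \<odot>\<^bsub>S\<^esub> q s)"
        using as f by (simp add: q f' pf S.act_closed)
    qed (use as q S.act_closed in auto)
    then show "restrict q (carrier S) (a \<odot>\<^bsub>S\<^esub> s) = a \<odot>\<^bsub>S\<^esub> restrict q (carrier S) s"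
      using as S.act_closed by simp
  qed (use q in auto)
  then show thesis by (rule that) (simp add: q)
qed

text \<open>
  A nonzero endomorphism of the dual comes from a nonzero, hence bijective, endomorphism \<open>\<psi>\<close> of
  \<open>S\<close>. Surjectivity of \<open>\<psi>\<close> makes precomposition with \<open>\<psi>\<close> injective, and precomposition
  with the inverse of \<open>\<psi>\<close> provides preimages.
\<close>

lemma simple_reflexive_dual_brick:
  assumes S: "simple_left_module A S" and refl: "left_reflexive A S"
  shows "brick A (left_dual A S)"
proof -
  let ?D = "left_dual A S"
  interpret S: left_module A S using S by (simp add: simple_left_module_def)
  interpret R: left_module A "left_regular A" by (rule S.A.left_regular_left_module)
  interpret D: right_module A ?D by (rule S.left_dual_right_module)
  have hom: "f \<in> mod_hom A S (left_regular A)" if "f \<in> carrier ?D" for f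
    using that by (simp add: left_dual_simps)
  have f0: "f \<zero>\<^bsub>S\<^esub> = \<zero>\<^bsub>A\<^esub>" if "f \<in> carrier ?D" for f
    using mod_hom_zero[OF S.abelian_group_axioms R.abelian_group_axioms hom[OF that]]
    by (simp add: left_regular_simps)
  show ?thesis
  proof (rule D.brickI)
    obtain s where s: "s \<in> carrier S" "s \<noteq> \<zero>\<^bsub>S\<^esub>"
      using S S.zero_closed unfolding simple_left_module_def by blast
    show "carrier ?D \<noteq> {\<zero>\<^bsub>?D\<^esub>}"
      using left_reflexive_separated[OF refl s(1) S.zero_closed] s by (auto simp: left_dual_simps(2))
  next
    fix \<phi> f assume \<phi>: "\<phi> \<in> mod_hom A ?D ?D" and f: "f \<in> carrier ?D" and nz: "\<phi> f \<noteq> \<zero>\<^bsub>?D\<^esub>"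
    obtain \<psi> where \<psi>: "\<psi> \<in> mod_hom A S S"
      and dual: "\<And>f s. \<lbrakk>f \<in> carrier ?D; s \<in> carrier S\<rbrakk> \<Longrightarrow> \<phi> f s = f (\<psi> s)"
      using reflexive_dual_endomorphism[OF refl \<phi>] by blast
    obtain s where s: "s \<in> carrier S" "\<phi> f s \<noteq> \<zero>\<^bsub>A\<^esub>"
      using nz left_dual_eqI[OF mod_hom_closed[OF \<phi> f] D.zero_closed]
      by (auto simp: left_dual_simps(2))
    then have "\<psi> s \<noteq> \<zero>\<^bsub>S\<^esub>" using dual[OF f s(1)] f0[OF f] by auto
    then have b: "bij_betw \<psi> (carrier S) (carrier S)"
      by (rule simple_endomorphism_bij[OF S \<psi> s(1)])
    have "inj_on \<phi> (carrier ?D)"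
    proof (rule inj_onI)
      fix g h assume gh: "g \<in> carrier ?D" "h \<in> carrier ?D" "\<phi> g = \<phi> h"
      show "g = h"
      proof (rule left_dual_eqI[OF gh(1,2)])
        fix t assume "t \<in> carrier S"
        then obtain s where "s \<in> carrier S" "t = \<psi> s" using b by (auto simp: bij_betw_def)
        then show "g t = h t" using dual[of g s] dual[of h s] gh by simp
      qed
    qed
    moreover have "g \<in> \<phi> ` carrier ?D" if g: "g \<in> carrier ?D" for g
    proof
      let ?i = "\<lambda>t\<in>carrier S. inv_into (carrier S) \<psi> t"
      show h: "compose (carrier S) g ?i \<in> carrier ?D"
        using S.mod_hom_compose[OF S.mod_hom_inverse[OF \<psi> b] hom[OF g]]
        by (simp add: left_dual_simps)
      show "g = \<phi> (compose (carrier S) g ?i)"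
      proof (rule left_dual_eqI[OF g mod_hom_closed[OF \<phi> h]])
        fix t assume t: "t \<in> carrier S"
        then show "g t = \<phi> (compose (carrier S) g ?i) t"
          using dual[OF h t] mod_hom_closed[OF \<psi> t] b
          by (simp add: compose_def bij_betw_def inv_into_f_f)
      qed
    qed
    ultimately show "bij_betw \<phi> (carrier ?D) (carrier ?D)"
      using mod_hom_closed[OF \<phi>] by (auto simp: bij_betw_def)
  qed
qed

theorem proposition4p1:
  fixes K :: "('k, 'l) ring_scheme"
    and A :: "('k, 'a, 'm) module_scheme"
    and S :: "('a, 's, 'n) module_scheme"
  assumes "algebraically_closed K"
    and "finite_dim_algebra K A"
    and "simple_left_module A S"
    and "left_reflexive A S"
  shows "right_torsionless A (left_dual A S)
    \<and> (\<forall>U. submodule U A (left_dual A S) \<and> U \<noteq> {\<zero>\<^bsub>left_dual A S\<^esub>} \<and> U \<noteq> carrier (left_dual A S)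
          \<longrightarrow> \<not> right_torsionless A (factor_module (left_dual A S) U))
    \<and> brick A (left_dual A S)"
  using simple_dual_torsionless[OF assms(3)]
    simple_reflexive_dual_factor_not_torsionless[OF assms(3,4)]
    simple_reflexive_dual_brick[OF assms(3,4)]
  by blast

end
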